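(* Suppose $(\mathcal S,\mathcal E,\lambda)$ satisfies detailed balance, that is, every edge $e=(x,y)\in\mathcal E$ has its reversal $e'=(y,x)$ in $\mathcal E$ and $$\lambda_e\,\pi(\partial_-e)=\lambda_{e'}\,\pi(\partial_-e')\qquad\text{for all }e\in\mathcal E .$$ Then the null drift condition holds: $$\bar U=\sum_{e\in\bar{\mathcal E}}\nu_e\lambda_e\pi(\partial_-e)=0.$$ As a special case, if the rates are reversible (i.e. for every $(x,y)\in\mathcal E$ one has $(y,x)\in\mathcal E$ and $\lambda(x,y)=\lambda(y,x)$), then the null drift condition holds.
   Context: A weighted directed graph is a triple $(\mathcal S,\mathcal E,\lambda)$ with $\mathcal S\subset\mathbb R^d$ a countable set of nodes, $\mathcal E\subset\mathcal S\times\mathcal S$ the directed edges, and $\lambda:\mathcal E\to(0,\infty)$; write $\lambda_e=\lambda(e)$. Standing assumptions: the graph is strongly connected, has no edges of the form $(y,y)$, and is invariant under integer translations (for $n\in\mathbb Z^d$: $x\in\mathcal S\Rightarrow x+n\in\mathcal S$; $(x,y)\in\mathcal E\Rightarrow(x+n,y+n)\in\mathcal E$ and $\lambda(x+n,y+n)=\lambda(x,y)$). For $e=(x,y)\in\mathcal E$: $\partial_-e=x$, $\partial_+e=y$, $\nu_e=y-x$. For $y\in\mathcal S$: $\mathcal E_y=\{e\in\mathcal E:\partial_-e=y\}$. $\bar{\mathcal S}$ is the quotient of $\mathcal S$ by $\mathbb Z^d$-translations, identified with $\mathcal S\cap[0,1)^d$. $\bar{\mathcal E}$ is the quotient of $\mathcal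 E$ by simultaneous translation of both endpoints by the same element of $\mathbb Z^d$, identified with $\bigcup_{y\in\bar{\mathcal S}}\mathcal E_y$. Both $\bar{\mathcal S}$ and $\bar{\mathcal E}$ are assumed finite. Functions on $\bar{\mathcal S}$ are evaluated at nodes of $\mathcal S$ by reducing modulo $\mathbb Z^d$. $(Lf)(y)=\sum_{e\in\mathcal E_y}(f(y+\nu_e)-f(y))\lambda_e$ for $f:\bar{\mathcal S}\to\mathbb R$, $y\in\bar{\mathcal S}$; $L^T$ is its transpose; $\pi$ is the unique function on $\bar{\mathcal S}$ with $L^T\pi=0$, $\sum_{y\in\bar{\mathcal S}}\pi(y)=1$ (the stationary distribution of the random walk projected to $\bar{\mathcal S}$). *)

theory Defs
  imports "HOL-Analysis.Analysis"
begin

definition int_vectors :: "(real ^ 'd) set" where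
  "int_vectors = {n. \<forall>i. n $ i \<in> \<int>}"

text \<open>Coordinatewise reduction modulo 1: the representative in \<open>[0,1)^d\<close> of the
  \<open>\<int>^d\<close>-orbit of a point.\<close>

definition reduce :: "real ^ 'd \<Rightarrow> real ^ 'd" where
  "reduce x = (\<chi> i. frac (x $ i))"

text \<open>An edge is a pair (source, target), so \<open>\<partial>\<^sub>-\<close> is \<^const>\<open>fst\<close>,
  \<open>\<partial>\<^sub>+\<close> is \<^const>\<open>snd\<close>, and the reversal of an edge is \<^const>\<open>prod.swap\<close>.\<close>

type_synonym 'd edge = "(real ^ 'd) \<times> (real ^ 'd)"

definition displacement :: "'d edge \<Rightarrow> real ^ 'd" where
  "displacement e = snd e - fst e"

definition out_edges :: "'d edge set \<Rightarrow> real ^ 'd \<Rightarrow> 'd edge set" where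
  "out_edges E y = {e \<in> E. fst e = y}"

text \<open>The quotients of the nodes and of the edges by integer translations, through their
  representatives: nodes in \<open>[0,1)^d\<close>, and edges starting at such nodes.\<close>

definition cell_nodes :: "(real ^ 'd) set \<Rightarrow> (real ^ 'd) set" where
  "cell_nodes S = S \<inter> {x. \<forall>i. 0 \<le> x $ i \<and> x $ i < 1}"

definition cell_edges :: "(real ^ 'd) set \<Rightarrow> 'd edge set \<Rightarrow> 'd edge set" where
  "cell_edges S E = (\<Union>y\<in>cell_nodes S. out_edges E y)"

locale periodic_weighted_digraph =
  fixes S :: "(real ^ 'd) set"
    and E :: "'d edge set"
    and rate :: "'d edge \<Rightarrow> real"
  assumes countable_nodes: "countable S"
    and edges_subset: "E \<subseteq> S \<times> S"
    and rate_pos: "e \<in> E \<Longrightarrow> 0 < rate e"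
    and strongly_connected: "x \<in> S \<Longrightarrow> y \<in> S \<Longrightarrow> (x, y) \<in> E\<^sup>*"
    and no_loops: "(y, y) \<notin> E"
    and nodes_periodic: "n \<in> int_vectors \<Longrightarrow> x \<in> S \<Longrightarrow> x + n \<in> S"
    and edges_periodic: "n \<in> int_vectors \<Longrightarrow> (x, y) \<in> E \<Longrightarrow> (x + n, y + n) \<in> E"
    and rate_periodic:
      "n \<in> int_vectors \<Longrightarrow> (x, y) \<in> E \<Longrightarrow> rate (x + n, y + n) = rate (x, y)"
    and finite_cell_nodes: "finite (cell_nodes S)"
    and finite_cell_edges: "finite (cell_edges S E)"

text \<open>A function on the node quotient is a function on \<^typ>\<open>real ^ 'd\<close> of which only the
  values on \<^term>\<open>cell_nodes S\<close> are used; other nodes are first passed through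
  \<^const>\<open>reduce\<close>.\<close>

definition generator ::
    "'d edge set \<Rightarrow> ('d edge \<Rightarrow> real) \<Rightarrow> (real ^ 'd \<Rightarrow> real) \<Rightarrow> real ^ 'd \<Rightarrow> real" where
  "generator E rate f y =
     (\<Sum>e\<in>out_edges E y. (f (reduce (y + displacement e)) - f y) * rate e)"

text \<open>The \<open>(y, x)\<close> matrix entry of the generator is its value at \<open>y\<close> on the indicator
  function of \<open>x\<close>.\<close>

definition generator_transpose ::
    "(real ^ 'd) set \<Rightarrow> 'd edge set \<Rightarrow> ('d edge \<Rightarrow> real) \<Rightarrow> (real ^ 'd \<Rightarrow> real) \<Rightarrow> real ^ 'd \<Rightarrow> real"
  where
  "generator_transpose S E rate g x =
     (\<Sum>y\<in>cell_nodes S. generator E rate (indicator {x}) y * g y)"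

definition stationary ::
    "(real ^ 'd) set \<Rightarrow> 'd edge set \<Rightarrow> ('d edge \<Rightarrow> real) \<Rightarrow> (real ^ 'd \<Rightarrow> real) \<Rightarrow> bool" where
  "stationary S E rate \<pi> \<longleftrightarrow>
     (\<forall>x\<in>cell_nodes S. generator_transpose S E rate \<pi> x = 0) \<and>
     (\<Sum>y\<in>cell_nodes S. \<pi> y) = 1"

definition detailed_balance ::
    "'d edge set \<Rightarrow> ('d edge \<Rightarrow> real) \<Rightarrow> (real ^ 'd \<Rightarrow> real) \<Rightarrow> bool" where
  "detailed_balance E rate \<pi> \<longleftrightarrow>
     (\<forall>e\<in>E. prod.swap e \<in> E \<and>
        rate e * \<pi> (reduce (fst e)) =
        rate (prod.swap e) * \<pi> (reduce (fst (prod.swap e))))"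

definition reversible_rates :: "'d edge set \<Rightarrow> ('d edge \<Rightarrow> real) \<Rightarrow> bool" where
  "reversible_rates E rate \<longleftrightarrow>
     (\<forall>x y. (x, y) \<in> E \<longrightarrow> (y, x) \<in> E \<and> rate (x, y) = rate (y, x))"

definition mean_drift ::
    "(real ^ 'd) set \<Rightarrow> 'd edge set \<Rightarrow> ('d edge \<Rightarrow> real) \<Rightarrow> (real ^ 'd \<Rightarrow> real) \<Rightarrow> real ^ 'd" where
  "mean_drift S E rate \<pi> =
     (\<Sum>e\<in>cell_edges S E. (rate e * \<pi> (reduce (fst e))) *\<^sub>R displacement e)"

end

theory Submission
  imports Defs
begin

text \<open>
  Reversing an edge negates its displacement. Composed with the integer translation that brings
  the new source back into the unit cell, reversal becomes an involution of the finite set of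
  edge classes (\<open>sum_cell_reverse\<close>). Detailed balance says that this involution preserves the
  weight \<open>\<lambda>\<^sub>e \<pi>(\<partial>\<^sub>-e)\<close>, so the drift equals its own negative.

  Reversible rates are reduced to detailed balance, for which \<open>\<pi>\<close> has to agree at the two ends
  of every edge. Pairing \<open>L\<^sup>T\<pi> = 0\<close> with \<open>\<pi>\<close> itself gives \<open>\<Sum>\<^sub>y \<pi>(y) (L\<pi>)(y) = 0\<close>. Averaging
  this sum over edges with its image under the involution turns it into a negative Dirichlet energy,
  \<open>-1/2 \<Sum>\<^sub>e \<lambda>\<^sub>e (\<pi>(\<partial>\<^sub>+e) - \<pi>(\<partial>\<^sub>-e))\<^sup>2\<close>, and since the rates are positive every difference
  vanishes (\<open>stationary_const_on_edges\<close>).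
\<close>

lemma reduce_diff_int_vectors: "reduce x - x \<in> int_vectors"
  by (simp add: reduce_def int_vectors_def frac_def)

lemma reduce_add_int_vector:
  assumes "n \<in> int_vectors"
  shows "reduce (x + n) = reduce x"
  using assms by (auto simp: reduce_def int_vectors_def vec_eq_iff frac_def elim!: Ints_cases)

lemma reduce_reduce [simp]: "reduce (reduce x) = reduce x"
  by (simp add: reduce_def vec_eq_iff)

lemma reduce_cell_node: "x \<in> cell_nodes S \<Longrightarrow> reduce x = x"
  by (simp add: cell_nodes_def reduce_def vec_eq_iff frac_eq)

lemma mem_cell_edges: "e \<in> cell_edges S E \<longleftrightarrow> e \<in> E \<and> fst e \<in> cell_nodes S"
  by (auto simp: cell_edges_def out_edges_def)

lemma generator_alt:
  "generator E rate f y = (\<Sum>e\<in>out_edges E y. (f (reduce (snd e)) - f y) * rate e)"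
  unfolding generator_def by (rule sum.cong) (auto simp: out_edges_def displacement_def)

text \<open>On edge classes this is the map induced by \<^const>\<open>prod.swap\<close>: the target of an edge need not
  lie in the unit cell, so the reversed edge is translated back by an integer vector.\<close>

definition cell_reverse :: "('d::finite) edge \<Rightarrow> 'd edge" where
  "cell_reverse e = (reduce (snd e), fst e + (reduce (snd e) - snd e))"

lemma fst_cell_reverse [simp]: "fst (cell_reverse e) = reduce (snd e)"
  by (simp add: cell_reverse_def)

lemma reduce_snd_cell_reverse [simp]: "reduce (snd (cell_reverse e)) = reduce (fst e)"
  by (simp add: cell_reverse_def reduce_add_int_vector reduce_diff_int_vectors)

lemma displacement_cell_reverse: "displacement (cell_reverse e) = - displacement e"
  by (simp add: cell_reverse_def displacement_def)

lemma cell_reverse_cell_reverse: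
  assumes "e \<in> cell_edges S E"
  shows "cell_reverse (cell_reverse e) = e"
proof -
  have "reduce (fst e) = fst e"
    using assms by (auto simp: mem_cell_edges intro: reduce_cell_node)
  then have "fst (cell_reverse (cell_reverse e)) = fst e"
    by simp
  moreover have "displacement (cell_reverse (cell_reverse e)) = displacement e"
    by (simp add: displacement_cell_reverse)
  ultimately show ?thesis
    by (simp add: displacement_def prod_eq_iff)
qed

context periodic_weighted_digraph
begin

lemma reduce_mem_cell_nodes:
  assumes "x \<in> S"
  shows "reduce x \<in> cell_nodes S"
proof -
  have "x + (reduce x - x) \<in> S"
    using assms by (intro nodes_periodic reduce_diff_int_vectors)
  then show ?thesis
    by (simp add: cell_nodes_def) (simp add: reduce_def frac_lt_1)
qed

lemma cell_reverse_mem_cell_edges: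
  assumes "e \<in> E" "prod.swap e \<in> E"
  shows "cell_reverse e \<in> cell_edges S E"
proof -
  have "(snd e + (reduce (snd e) - snd e), fst e + (reduce (snd e) - snd e)) \<in> E"
    using assms by (intro edges_periodic reduce_diff_int_vectors) (simp add: prod.swap_def)
  moreover have "snd e \<in> S"
    using assms edges_subset by auto
  ultimately show ?thesis
    by (simp add: mem_cell_edges reduce_mem_cell_nodes) (simp add: cell_reverse_def)
qed

lemma rate_cell_reverse:
  assumes "prod.swap e \<in> E"
  shows "rate (cell_reverse e) = rate (prod.swap e)"
  using rate_periodic[OF reduce_diff_int_vectors[of "snd e"], of "snd e" "fst e"] assms
  by (simp add: cell_reverse_def prod.swap_def)

lemma sum_cell_reverse:
  fixes F :: "'d edge \<Rightarrow> 'b::comm_monoid_add"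
  assumes "\<And>e. e \<in> E \<Longrightarrow> prod.swap e \<in> E"
  shows "(\<Sum>e\<in>cell_edges S E. F (cell_reverse e)) = (\<Sum>e\<in>cell_edges S E. F e)"
proof (rule sum.reindex_bij_witness[where i = cell_reverse and j = cell_reverse])
  show "cell_reverse (cell_reverse e) = e" if "e \<in> cell_edges S E" for e
    using that by (rule cell_reverse_cell_reverse)
  show "cell_reverse (cell_reverse e) = e" if "e \<in> cell_edges S E" for e
    using that by (rule cell_reverse_cell_reverse)
  show "cell_reverse e \<in> cell_edges S E" if "e \<in> cell_edges S E" for e
    using that by (intro cell_reverse_mem_cell_edges assms) (simp_all add: mem_cell_edges)
  show "cell_reverse e \<in> cell_edges S E" if "e \<in> cell_edges S E" for e
    using that by (intro cell_reverse_mem_cell_edges assms) (simp_all add: mem_cell_edges)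
qed simp

theorem detailed_balance_imp_mean_drift_eq_0:
  assumes db: "detailed_balance E rate p"
  shows "mean_drift S E rate p = 0"
proof -
  define F where "F e = (rate e * p (reduce (fst e))) *\<^sub>R displacement e" for e
  have swap: "prod.swap e \<in> E" if "e \<in> E" for e
    using db that by (simp add: detailed_balance_def)
  have "F (cell_reverse e) = - F e" if "e \<in> cell_edges S E" for e
  proof -
    have "e \<in> E"
      using that by (simp add: mem_cell_edges)
    then have "rate e * p (reduce (fst e)) = rate (prod.swap e) * p (reduce (snd e))"
      using db by (auto simp: detailed_balance_def)
    then show ?thesis
      using swap[OF \<open>e \<in> E\<close>] by (simp add: F_def rate_cell_reverse displacement_cell_reverse)
  qed
  then have "mean_drift S E rate p = - mean_drift S E rate p"
    using sum_cell_reverse[OF swap, of F] by (simp add: sum_negf mean_drift_def F_def)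
  then show ?thesis
    by (simp add: vec_eq_iff)
qed

lemma finite_out_edges:
  assumes "y \<in> cell_nodes S"
  shows "finite (out_edges E y)"
  using assms by (intro finite_subset[OF _ finite_cell_edges]) (auto simp: cell_edges_def)

text \<open>A function on the finite node quotient is the combination of the point indicators weighted
  by its values, and the generator is linear.\<close>

lemma generator_indicator_expansion:
  assumes y: "y \<in> cell_nodes S"
  shows "(\<Sum>x\<in>cell_nodes S. g x * generator E rate (indicator {x}) y) = generator E rate g y"
proof -
  have point: "(\<Sum>x\<in>cell_nodes S. g x * indicator {x} z) = g z" if "z \<in> cell_nodes S" for z
    using that finite_cell_nodes by (simp add: indicator_def if_distrib cong: if_cong)
  have "(\<Sum>x\<in>cell_nodes S. g x * generator E rate (indicator {x}) y) =
      (\<Sum>e\<in>out_edges E y. \<Sum>x\<in>cell_nodes S.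
         g x * ((indicator {x} (reduce (snd e)) - indicator {x} y) * rate e))"
    unfolding generator_alt sum_distrib_left by (rule sum.swap)
  also have "\<dots> = (\<Sum>e\<in>out_edges E y.
      ((\<Sum>x\<in>cell_nodes S. g x * indicator {x} (reduce (snd e))) -
       (\<Sum>x\<in>cell_nodes S. g x * indicator {x} y)) * rate e)"
    by (simp only: sum_distrib_right sum_subtractf[symmetric] left_diff_distrib right_diff_distrib mult.assoc)
  also have "\<dots> = generator E rate g y"
    unfolding generator_alt
  proof (rule sum.cong)
    fix e assume "e \<in> out_edges E y"
    then have "snd e \<in> S"
      using edges_subset by (auto simp: out_edges_def)
    then show "((\<Sum>x\<in>cell_nodes S. g x * indicator {x} (reduce (snd e))) -
        (\<Sum>x\<in>cell_nodes S. g x * indicator {x} y)) * rate e =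
        (g (reduce (snd e)) - g y) * rate e"
      using y by (simp add: point reduce_mem_cell_nodes)
  qed simp
  finally show ?thesis .
qed

lemma generator_transpose_adjoint:
  "(\<Sum>x\<in>cell_nodes S. g x * generator_transpose S E rate p x) =
   (\<Sum>y\<in>cell_nodes S. generator E rate g y * p y)"
proof -
  have "(\<Sum>x\<in>cell_nodes S. g x * generator_transpose S E rate p x) =
      (\<Sum>y\<in>cell_nodes S. \<Sum>x\<in>cell_nodes S. g x * (generator E rate (indicator {x}) y * p y))"
    unfolding generator_transpose_def sum_distrib_left by (rule sum.swap)
  also have "\<dots> = (\<Sum>y\<in>cell_nodes S.
      (\<Sum>x\<in>cell_nodes S. g x * generator E rate (indicator {x}) y) * p y)"
    by (simp add: sum_distrib_right mult.assoc)
  finally show ?thesis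
    by (simp add: generator_indicator_expansion)
qed

lemma sum_generator_eq_sum_cell_edges:
  "(\<Sum>y\<in>cell_nodes S. generator E rate g y * p y) =
   (\<Sum>e\<in>cell_edges S E. (g (reduce (snd e)) - g (fst e)) * rate e * p (fst e))"
proof -
  have "(\<Sum>e\<in>cell_edges S E. (g (reduce (snd e)) - g (fst e)) * rate e * p (fst e)) =
      (\<Sum>y\<in>cell_nodes S. \<Sum>e\<in>out_edges E y.
         (g (reduce (snd e)) - g (fst e)) * rate e * p (fst e))"
    unfolding cell_edges_def
    by (rule sum.UNION_disjoint)
       (use finite_cell_nodes finite_out_edges in \<open>auto simp: out_edges_def\<close>)
  also have "\<dots> = (\<Sum>y\<in>cell_nodes S. generator E rate g y * p y)"
    unfolding generator_alt sum_distrib_right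
    by (intro sum.cong) (auto simp: out_edges_def)
  finally show ?thesis ..
qed

text \<open>For symmetric rates, pairing the equation \<open>L\<^sup>T p = 0\<close> with \<open>p\<close> leaves a negative
  Dirichlet energy: an edge and its reversal contribute \<open>(b - a) a \<lambda>\<close> and
  \<open>(a - b) b \<lambda>\<close>, where \<open>a\<close> and \<open>b\<close> are the values of \<open>p\<close> at the two ends, and these add up to
  \<open>- \<lambda> (b - a)\<^sup>2\<close>. A vanishing sum of terms of one sign has only zero terms.\<close>

lemma stationary_const_on_edges:
  assumes rev: "reversible_rates E rate"
    and stat: "\<And>x. x \<in> cell_nodes S \<Longrightarrow> generator_transpose S E rate p x = 0"
    and e: "e \<in> E"
  shows "p (reduce (fst e)) = p (reduce (snd e))"
proof -
  define F where "F e = (p (reduce (snd e)) - p (fst e)) * rate e * p (fst e)" for e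
  have swap: "prod.swap e \<in> E" and rate_swap: "rate (prod.swap e) = rate e" if "e \<in> E" for e
    using rev that by (cases e; auto simp: reversible_rates_def)+
  have total: "(\<Sum>e\<in>cell_edges S E. F e) = 0"
    using generator_transpose_adjoint[of p p] stat
    by (simp add: F_def sum_generator_eq_sum_cell_edges)
  have energy: "F e + F (cell_reverse e) = - (rate e * (p (reduce (snd e)) - p (fst e))\<^sup>2)"
    if "e \<in> cell_edges S E" for e
  proof -
    have "e \<in> E" "reduce (fst e) = fst e"
      using that by (auto simp: mem_cell_edges intro: reduce_cell_node)
    then show ?thesis
      by (simp add: F_def rate_cell_reverse swap rate_swap power2_eq_square algebra_simps)
  qed
  have "(\<Sum>e\<in>cell_edges S E. F e + F (cell_reverse e)) = 0"
    using total sum_cell_reverse[OF swap, of F] by (simp add: sum.distrib)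
  then have "(\<Sum>e\<in>cell_edges S E. rate e * (p (reduce (snd e)) - p (fst e))\<^sup>2) = 0"
    by (simp add: energy sum_negf)
  moreover have "0 \<le> rate e * (p (reduce (snd e)) - p (fst e))\<^sup>2" if "e \<in> cell_edges S E" for e
    using that rate_pos[of e] by (simp add: mem_cell_edges)
  ultimately have "\<forall>e\<in>cell_edges S E. rate e * (p (reduce (snd e)) - p (fst e))\<^sup>2 = 0"
    by (subst (asm) sum_nonneg_eq_0_iff[OF finite_cell_edges])
  moreover
  \<comment> \<open>An arbitrary edge is represented in the cell by its translated reversal.\<close>
  have "cell_reverse e \<in> cell_edges S E"
    using e by (intro cell_reverse_mem_cell_edges swap)
  ultimately have "rate (cell_reverse e) * (p (reduce (fst e)) - p (reduce (snd e)))\<^sup>2 = 0"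
    by fastforce
  moreover have "rate (cell_reverse e) \<noteq> 0"
    using rate_pos[OF e] e by (simp add: rate_cell_reverse swap rate_swap)
  ultimately show ?thesis
    by simp
qed

lemma reversible_rates_imp_detailed_balance:
  assumes rev: "reversible_rates E rate"
    and stat: "\<And>x. x \<in> cell_nodes S \<Longrightarrow> generator_transpose S E rate p x = 0"
  shows "detailed_balance E rate p"
  unfolding detailed_balance_def
proof
  fix e assume e: "e \<in> E"
  have "prod.swap e \<in> E \<and> rate (prod.swap e) = rate e"
    using rev e by (cases e) (auto simp: reversible_rates_def)
  then show "prod.swap e \<in> E \<and>
      rate e * p (reduce (fst e)) = rate (prod.swap e) * p (reduce (fst (prod.swap e)))"
    using stationary_const_on_edges[OF rev stat e] by simp
qed

end

theorem theorem4p2: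
  fixes S :: "(real ^ 'd) set"
    and E :: "((real ^ 'd) \<times> (real ^ 'd)) set"
    and rate :: "(real ^ 'd) \<times> (real ^ 'd) \<Rightarrow> real"
    and \<pi> :: "real ^ 'd \<Rightarrow> real"
  assumes "periodic_weighted_digraph S E rate"
    and "stationary S E rate \<pi>"
  shows "(detailed_balance E rate \<pi> \<longrightarrow> mean_drift S E rate \<pi> = 0) \<and>
         (reversible_rates E rate \<longrightarrow> mean_drift S E rate \<pi> = 0)"
proof -
  interpret periodic_weighted_digraph S E rate
    by fact
  have "detailed_balance E rate \<pi>" if "reversible_rates E rate"
    using that assms(2) by (intro reversible_rates_imp_detailed_balance) (auto simp: stationary_def)
  then show ?thesis
    using detailed_balance_imp_mean_drift_eq_0 by blast
qed

end
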